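(* Let $q\ge1$ be an integer, $0<\alpha<1$, and let $f_X$ be a probability density on $\mathbb{R}$ that is symmetric, $f_X(-x)=f_X(x)$ for all $x$, with $\int|x|^{2q}f_X(x)\,dx<\infty$. Consider polynomial regression of degree $q$, and let $\xi^*$ be the $D$-optimal subsampling design of mass $\alpha$, with density $$f_{\xi^*}(x)=\sum_{k=0}^r f_X(x)\,\mathbf{1}_{\mathcal{I}_k}(x),$$ where $1\le r\le q$, $a_1>\dots>a_{2r}$, $\mathcal{I}_0=[a_1,\infty)$, $\mathcal{I}_k=[a_{2k+1},a_{2k}]$ for $k=1,\dots,r-1$, $\mathcal{I}_r=(-\infty,a_{2r}]$, and where, for some threshold $s^*$, $\psi(x,\xi^* )\ge s^*$ for $x\in\bigcup_{k=0}^r\mathcal{I}_k$ and $\psi(x,\xi^* )<s^*$ for $x\notin\bigcup_{k=0}^r\mathcal{I}_k$. Then the boundaries are symmetric: $a_{2r+1-k}=-a_k$ for $k=1,\dots,2r$, and, accordingly, $\mathcal{I}_{r-k}=-\mathcal{I}_k$ for $k=0,\dots,r$.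
   Context: Polynomial regression of degree $q$: $\mathbf{f}(x)=(1,x,\dots,x^q)^\top$. A (continuous) subsampling design $\xi$ is a measure on $\mathbb{R}$ with Lebesgue density $f_\xi$ satisfying $0\le f_\xi(x)\le f_X(x)$ for all $x$ and $\int f_\xi(x)\,dx=\alpha$ (densities are understood up to Lebesgue null sets). Its information matrix is $\mathbf{M}(\xi)=\int \mathbf{f}(x)\mathbf{f}(x)^\top f_\xi(x)\,dx$, which is always nonsingular. A subsampling design is $D$-optimal if it maximizes $\log\det\mathbf{M}(\xi)$ among all subsampling designs $\xi$. The sensitivity function is $\psi(x,\xi)=\alpha\,\mathbf{f}(x)^\top\mathbf{M}(\xi)^{-1}\mathbf{f}(x)$. $\mathbf{1}_A$ is the indicator function of $A$, and $-A=\{-x:x\in A\}$. *)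

theory Defs
  imports
    "HOL-Probability.Probability_Measure"
    "Jordan_Normal_Form.Determinant"
    "Jordan_Normal_Form.Gauss_Jordan_Elimination"
begin

(* det, vec and the scalar product exist both in HOL-Analysis (type-indexed dimension) and in
   Jordan_Normal_Form (dimension a natural number).  The latter versions are used throughout,
   by qualified name or prefix form, because the dimension q + 1 depends on the degree q. *)

definition is_prob_density :: "(real \<Rightarrow> real) \<Rightarrow> bool" where
  "is_prob_density fX \<longleftrightarrow>
     fX \<in> borel_measurable borel \<and> (\<forall>x. 0 \<le> fX x) \<and>
     prob_space (density lborel (\<lambda>x. ennreal (fX x)))"

(* A design is a measure, so that two densities agreeing outside a Lebesgue null set describe
   the same design; the bounds are required of some version of its density. *)

definition subsampling_design :: "(real \<Rightarrow> real) \<Rightarrow> real \<Rightarrow> real measure \<Rightarrow> bool" where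
  "subsampling_design fX \<alpha> \<xi> \<longleftrightarrow>
     (\<exists>f. f \<in> borel_measurable borel \<and>
          (\<forall>x. 0 \<le> f x \<and> f x \<le> fX x) \<and>
          integrable lborel f \<and> (\<integral>x. f x \<partial>lborel) = \<alpha> \<and>
          \<xi> = density lborel (\<lambda>x. ennreal (f x)))"

definition regression_vec :: "nat \<Rightarrow> real \<Rightarrow> real Matrix.vec" where
  "regression_vec q x = Matrix.vec (q + 1) (\<lambda>i. x ^ i)"

(* Entrywise integral of the regression vector times its transpose; the lemma rewrites it as an
   integral against a Lebesgue density of the design. *)

definition information_matrix :: "nat \<Rightarrow> real measure \<Rightarrow> real Matrix.mat" where
  "information_matrix q \<xi> =
     Matrix.mat (q + 1) (q + 1)
       (\<lambda>(i, j). \<integral>x. vec_index (regression_vec q x) i * vec_index (regression_vec q x) j \<partial>\<xi>)"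

lemma information_matrix_density:
  assumes "f \<in> borel_measurable borel" "\<And>x. 0 \<le> f x"
  shows "information_matrix q (density lborel (\<lambda>x. ennreal (f x))) =
    Matrix.mat (q + 1) (q + 1) (\<lambda>(i, j). \<integral>x. x ^ i * x ^ j * f x \<partial>lborel)"
  unfolding information_matrix_def regression_vec_def
  using assms by (intro eq_matI) (simp_all add: integral_real_density mult.commute)

definition D_optimal :: "nat \<Rightarrow> (real \<Rightarrow> real) \<Rightarrow> real \<Rightarrow> real measure \<Rightarrow> bool" where
  "D_optimal q fX \<alpha> \<xi> \<longleftrightarrow>
     subsampling_design fX \<alpha> \<xi> \<and>
     (\<forall>\<eta>. subsampling_design fX \<alpha> \<eta> \<longrightarrow>
        ln (Determinant.det (information_matrix q \<eta>))
          \<le> ln (Determinant.det (information_matrix q \<xi>)))"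

(* mat_inverse returns None only for a singular matrix, which an information matrix of a design
   of positive mass never is. *)

definition sensitivity :: "nat \<Rightarrow> real \<Rightarrow> real measure \<Rightarrow> real \<Rightarrow> real" where
  "sensitivity q \<alpha> \<xi> x =
     \<alpha> * scalar_prod (regression_vec q x)
           (mult_mat_vec (the (mat_inverse (information_matrix q \<xi>))) (regression_vec q x))"

definition support_interval :: "(nat \<Rightarrow> real) \<Rightarrow> nat \<Rightarrow> nat \<Rightarrow> real set" where
  "support_interval a r k =
     (if k = 0 then {a 1..}
      else if k = r then {..a (2 * r)}
      else {a (2 * k + 1)..a (2 * k)})"

end

theory Submission
  imports Defs
begin

text \<open>
  The information matrix of a design is the Hankel matrix of its moments, so its determinant is
  the product of the squared norms of the monic orthogonal polynomials.  Averaging the optimal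
  design with its mirror image gives another admissible design.  Each squared norm is a minimum
  over monic polynomials, hence can only grow under this averaging, while optimality forbids the
  product to grow.  So all norms agree, minimisers being unique the orthogonal polynomials agree
  as well, and the two information matrices coincide.  Thus the odd moments vanish, the
  sensitivity function is even, and its superlevel set is symmetric about the origin.  The
  boundary points of that set are exactly the \<open>a\<^sub>i\<close>.
\<close>

subsection \<open>Orthogonal polynomials and Hankel determinants\<close>

text \<open>The linear functional on polynomials that sends the monomial of degree \<open>i\<close>
  to \<open>m i\<close>; for the moments of a measure it is integration.\<close>

definition moment_functional :: "(nat \<Rightarrow> real) \<Rightarrow> real poly \<Rightarrow> real" where
  "moment_functional m p = (\<Sum>i\<le>degree p. coeff p i * m i)"

lemma moment_functional_eq:
  assumes "degree p \<le> n"
  shows "moment_functional m p = (\<Sum>i\<le>n. coeff p i * m i)"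
  unfolding moment_functional_def
  by (rule sum.mono_neutral_left) (use assms in \<open>auto simp: coeff_eq_0\<close>)

lemma moment_functional_add:
  "moment_functional m (p + r) = moment_functional m p + moment_functional m r"
proof -
  define n where "n = max (degree p) (degree r)"
  have "degree (p + r) \<le> n" "degree p \<le> n" "degree r \<le> n"
    unfolding n_def by (auto intro: degree_add_le_max)
  then show ?thesis
    by (simp add: moment_functional_eq[where n = n] sum.distrib algebra_simps)
qed

lemma moment_functional_smult: "moment_functional m (Polynomial.smult c p) = c * moment_functional m p"
  by (simp add: moment_functional_eq[where n = "degree p"] sum_distrib_left mult.assoc)

lemma moment_functional_0: "moment_functional m 0 = 0"
  by (simp add: moment_functional_def)

lemma moment_functional_diff:
  "moment_functional m (p - r) = moment_functional m p - moment_functional m r"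
  using moment_functional_add[of m "p - r" r] by simp

lemma moment_functional_sum:
  "moment_functional m (sum g I) = (\<Sum>i\<in>I. moment_functional m (g i))"
  by (induction I rule: infinite_finite_induct)
    (simp_all add: moment_functional_0 moment_functional_add)

lemma moment_functional_monom: "moment_functional m (monom c k) = c * m k"
proof -
  have "moment_functional m (monom c k) = (\<Sum>i\<le>k. coeff (monom c k) i * m i)"
    by (rule moment_functional_eq) (rule degree_monom_le)
  also have "\<dots> = (\<Sum>i\<le>k. if i = k then c * m k else 0)"
    by (rule sum.cong) simp_all
  finally show ?thesis by simp
qed

lemma moment_functional_mult:
  assumes "degree p \<le> n" "degree r \<le> n"
  shows "moment_functional m (p * r) =
    (\<Sum>i\<le>n. \<Sum>j\<le>n. coeff p i * coeff r j * m (i + j))"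
proof -
  have "p * r = (\<Sum>i\<le>n. monom (coeff p i) i) * (\<Sum>j\<le>n. monom (coeff r j) j)"
    using assms by (simp add: poly_as_sum_of_monoms')
  then show ?thesis
    by (simp add: sum_product mult_monom moment_functional_sum moment_functional_monom)
qed

section \<open>Monic orthogonal polynomials of a positive definite moment sequence\<close>

definition positive_moments :: "(nat \<Rightarrow> real) \<Rightarrow> nat \<Rightarrow> bool" where
  "positive_moments m n \<longleftrightarrow>
     (\<forall>p. p \<noteq> 0 \<longrightarrow> degree p \<le> n \<longrightarrow> 0 < moment_functional m (p * p))"

text \<open>Degree below \<open>k\<close> is expressed by vanishing coefficients: this passes
  directly to differences and from \<open>d\<close> to \<open>Suc d\<close>, and for
  \<open>k = 0\<close> it admits only \<open>p = 0\<close>.\<close>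

definition monic_orthogonal :: "(nat \<Rightarrow> real) \<Rightarrow> nat \<Rightarrow> real poly \<Rightarrow> bool" where
  "monic_orthogonal m k P \<longleftrightarrow> degree P \<le> k \<and> coeff P k = 1 \<and>
     (\<forall>p. (\<forall>i\<ge>k. coeff p i = 0) \<longrightarrow> moment_functional m (P * p) = 0)"

text \<open>Gram-Schmidt: strong induction supplies the orthogonal polynomials of lower degree,
  whose components are removed from the monomial of degree \<open>k\<close> one after another.
  Positivity keeps the denominators nonzero.\<close>

lemma monic_orthogonal_exists:
  assumes "positive_moments m n" "k \<le> n"
  shows "\<exists>P. monic_orthogonal m k P"
  using assms(2)
proof (induction k rule: less_induct)
  case (less k)
  \<comment> \<open>After \<open>d\<close> Gram-Schmidt steps, orthogonality is asked only against
    polynomials of degree below \<open>d\<close>; the case \<open>d = k\<close> is the goal.\<close>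
  have "\<exists>P. degree P \<le> k \<and> coeff P k = 1 \<and>
      (\<forall>p. (\<forall>i\<ge>d. coeff p i = 0) \<longrightarrow> moment_functional m (P * p) = 0)" if "d \<le> k" for d
    using that
  proof (induction d)
    case 0
    have "moment_functional m (monom 1 k * p) = 0" if "\<forall>i\<ge>0. coeff p i = 0" for p
    proof -
      have "p = 0" using that by (intro poly_eqI) simp
      then show ?thesis by (simp add: moment_functional_0)
    qed
    then show ?case
      by (intro exI[of _ "monom 1 k"]) (simp add: degree_monom_le)
  next
    case (Suc d)
    then obtain P where P: "degree P \<le> k" "coeff P k = 1"
      and orth: "\<And>p. (\<forall>i\<ge>d. coeff p i = 0) \<Longrightarrow> moment_functional m (P * p) = 0"
      by auto
    obtain Q where "monic_orthogonal m d Q"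
      using less Suc.prems by (meson Suc_le_lessD less_imp_le order_trans)
    then have Q: "degree Q \<le> d" "coeff Q d = 1"
      and orthQ: "\<And>p. (\<forall>i\<ge>d. coeff p i = 0) \<Longrightarrow> moment_functional m (Q * p) = 0"
      by (auto simp: monic_orthogonal_def)
    have "Q \<noteq> 0" "degree Q \<le> n"
      using Q Suc.prems less.prems by auto
    then have "0 < moment_functional m (Q * Q)"
      using assms(1) by (simp add: positive_moments_def)
    define c where "c = moment_functional m (P * Q) / moment_functional m (Q * Q)"
    define P' where "P' = P - Polynomial.smult c Q"
    have PQ: "moment_functional m (P' * Q) = 0"
      using \<open>0 < moment_functional m (Q * Q)\<close>
      by (simp add: P'_def c_def left_diff_distrib moment_functional_diff moment_functional_smult)
    have "moment_functional m (P' * p) = 0" if "\<forall>i\<ge>Suc d. coeff p i = 0" for p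
    proof -
      \<comment> \<open>As \<open>Q\<close> is monic of degree \<open>d\<close>, this cancels the
        coefficient of degree \<open>d\<close>. So \<open>p\<close> splits into \<open>r\<close>, to
        which both \<open>P\<close> and \<open>Q\<close> are orthogonal, and a multiple of
        \<open>Q\<close>, covered by \<open>PQ\<close>.\<close>
      define r where "r = p - Polynomial.smult (coeff p d) Q"
      have "coeff r i = 0" if "i \<ge> d" for i
        using that Q \<open>\<forall>i\<ge>Suc d. coeff p i = 0\<close>
        by (cases "i = d") (auto simp: r_def coeff_eq_0)
      then have "moment_functional m (P' * r) = 0"
        using orth[of r] orthQ[of r]
        by (simp add: P'_def left_diff_distrib moment_functional_diff moment_functional_smult)
      moreover have "P' * p = P' * r + Polynomial.smult (coeff p d) (P' * Q)"
        by (simp add: r_def algebra_simps)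
      ultimately show ?thesis
        using PQ by (simp add: moment_functional_add moment_functional_smult)
    qed
    moreover have "degree P' \<le> k" "coeff P' k = 1"
      using P Q Suc.prems unfolding P'_def
      by (auto intro!: degree_diff_le order_trans[OF degree_smult_le] simp: coeff_eq_0)
    ultimately show ?case by blast
  qed
  from this[of k] show ?case by (auto simp: monic_orthogonal_def)
qed

text \<open>Pythagoras: the leading terms of \<open>Q\<close> and \<open>P\<close> cancel, so
  \<open>Q - P\<close> has degree below \<open>k\<close> and is orthogonal to
  \<open>P\<close>.\<close>

lemma monic_orthogonal_decomposition:
  assumes "monic_orthogonal m k P" "degree Q \<le> k" "coeff Q k = 1"
  shows "moment_functional m (Q * Q) =
    moment_functional m (P * P) + moment_functional m ((Q - P) * (Q - P))"
proof -
  have "coeff (Q - P) i = 0" if "i \<ge> k" for i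
    using that assms by (cases "i = k") (auto simp: monic_orthogonal_def coeff_eq_0)
  then have "moment_functional m (P * (Q - P)) = 0"
    using assms(1) by (auto simp: monic_orthogonal_def)
  moreover have "Q * Q = P * P + 2 * (P * (Q - P)) + (Q - P) * (Q - P)"
    by (simp add: algebra_simps)
  then have "Q * Q = P * P + Polynomial.smult 2 (P * (Q - P)) + (Q - P) * (Q - P)"
    by (metis mult_2 smult_add_left one_add_one smult_1_left)
  ultimately show ?thesis by (simp add: moment_functional_add moment_functional_smult)
qed

text \<open>The additional Pythagorean term is positive unless \<open>Q = P\<close>. The equality
  case later identifies the orthogonal polynomials of two different functionals.\<close>

lemma monic_orthogonal_minimal:
  assumes "positive_moments m n" "k \<le> n" "monic_orthogonal m k P" "degree Q \<le> k" "coeff Q k = 1"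
  shows "moment_functional m (P * P) \<le> moment_functional m (Q * Q)"
    and "moment_functional m (Q * Q) \<le> moment_functional m (P * P) \<Longrightarrow> Q = P"
proof -
  have "degree (Q - P) \<le> n"
    using assms by (auto intro!: degree_diff_le simp: monic_orthogonal_def)
  then have pos: "0 < moment_functional m ((Q - P) * (Q - P))" if "Q \<noteq> P"
    using assms(1) that by (simp add: positive_moments_def)
  have eq: "moment_functional m (Q * Q) =
      moment_functional m (P * P) + moment_functional m ((Q - P) * (Q - P))"
    by (rule monic_orthogonal_decomposition[OF assms(3-5)])
  show "moment_functional m (P * P) \<le> moment_functional m (Q * Q)"
    using eq pos by (cases "Q = P") auto
  show "Q = P" if "moment_functional m (Q * Q) \<le> moment_functional m (P * P)"
    using eq pos that by (cases "Q = P") auto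
qed

lemma monic_orthogonal_norm_pos:
  assumes "positive_moments m n" "k \<le> n" "monic_orthogonal m k P"
  shows "0 < moment_functional m (P * P)"
proof -
  have "P \<noteq> 0" "degree P \<le> n"
    using assms(2,3) by (auto simp: monic_orthogonal_def)
  then show ?thesis using assms(1) by (simp add: positive_moments_def)
qed

section \<open>Hankel matrices and their determinants\<close>

definition hankel_mat :: "(nat \<Rightarrow> real) \<Rightarrow> nat \<Rightarrow> real Matrix.mat" where
  "hankel_mat m n = Matrix.mat (Suc n) (Suc n) (\<lambda>(i, j). m (i + j))"

text \<open>The change of basis from the monomials to the family \<open>P\<close>; unit lower
  triangular when each \<open>P k\<close> is monic of degree \<open>k\<close>.\<close>

definition coeff_mat :: "(nat \<Rightarrow> real poly) \<Rightarrow> nat \<Rightarrow> real Matrix.mat" where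
  "coeff_mat P n = Matrix.mat (Suc n) (Suc n) (\<lambda>(i, j). coeff (P i) j)"

lemma hankel_mat_carrier [simp]: "hankel_mat m n \<in> carrier_mat (Suc n) (Suc n)"
  and coeff_mat_carrier [simp]: "coeff_mat P n \<in> carrier_mat (Suc n) (Suc n)"
  by (simp_all add: hankel_mat_def coeff_mat_def)

text \<open>The Hankel matrix is the Gram matrix of the monomials, so a change of basis acts on it
  by congruence and yields the Gram matrix of \<open>P\<close>.\<close>

lemma coeff_mat_hankel_mat:
  assumes "\<And>k. k \<le> n \<Longrightarrow> degree (P k) \<le> n"
  shows "coeff_mat P n * hankel_mat m n * Matrix.transpose_mat (coeff_mat P n) =
    Matrix.mat (Suc n) (Suc n) (\<lambda>(i, j). moment_functional m (P i * P j))"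
proof (rule eq_matI)
  fix i j
  assume "i < dim_row (Matrix.mat (Suc n) (Suc n) (\<lambda>(i, j). moment_functional m (P i * P j)))"
    and "j < dim_col (Matrix.mat (Suc n) (Suc n) (\<lambda>(i, j). moment_functional m (P i * P j)))"
  then have ij: "i < Suc n" "j < Suc n" by simp_all
  \<comment> \<open>The sums are interchanged to match the order in which the triple matrix product
    unfolds.\<close>
  have "moment_functional m (P i * P j) =
      (\<Sum>l\<le>n. \<Sum>k\<le>n. coeff (P i) k * coeff (P j) l * m (k + l))"
    using ij assms moment_functional_mult[of "P i" n "P j" m]
      sum.swap[of "\<lambda>k l. coeff (P i) k * coeff (P j) l * m (k + l)" "{..n}" "{..n}"]
    by simp
  then show "(coeff_mat P n * hankel_mat m n * Matrix.transpose_mat (coeff_mat P n)) $$ (i, j) =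
      Matrix.mat (Suc n) (Suc n) (\<lambda>(i, j). moment_functional m (P i * P j)) $$ (i, j)"
    using ij
    by (simp add: hankel_mat_def coeff_mat_def scalar_prod_def sum_distrib_right sum_distrib_left
        atLeast0LessThan lessThan_Suc_atMost mult_ac)
qed (simp_all add: coeff_mat_def)

lemma coeff_mat_hankel_mat_orthogonal:
  assumes "\<And>k. k \<le> n \<Longrightarrow> monic_orthogonal m k (P k)"
  shows "coeff_mat P n * hankel_mat m n * Matrix.transpose_mat (coeff_mat P n) =
    Matrix.mat (Suc n) (Suc n) (\<lambda>(i, j). if i = j then moment_functional m (P i * P i) else 0)"
proof -
  have deg: "degree (P k) \<le> k" if "k \<le> n" for k
    using assms[OF that] by (simp add: monic_orthogonal_def)
  \<comment> \<open>Orthogonality is given only against lower degrees; the entries on the other side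
    of the diagonal follow by commutativity.\<close>
  have lt: "moment_functional m (P i * P j) = 0" if "j < i" "i \<le> n" for i j
  proof -
    have "coeff (P j) l = 0" if "l \<ge> i" for l
      using that \<open>j < i\<close> deg[of j] \<open>i \<le> n\<close> by (intro coeff_eq_0) simp
    then show ?thesis
      using assms[OF \<open>i \<le> n\<close>] by (simp add: monic_orthogonal_def)
  qed
  have "moment_functional m (P i * P j) = 0" if "i \<noteq> j" "i \<le> n" "j \<le> n" for i j
    using lt[of i j] lt[of j i] that by (cases i j rule: linorder_cases) (auto simp: mult.commute)
  moreover have "degree (P k) \<le> n" if "k \<le> n" for k
    using deg[OF that] that by simp
  ultimately show ?thesis
    by (subst coeff_mat_hankel_mat) (auto intro!: cong_mat)
qed

lemma det_coeff_mat:
  assumes "\<And>k. k \<le> n \<Longrightarrow> degree (P k) \<le> k \<and> coeff (P k) k = 1"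
  shows "Determinant.det (coeff_mat P n) = 1"
proof -
  have "coeff (P i) j = 0" if "i < j" "j < Suc n" for i j
    using that assms[of i] by (intro coeff_eq_0) simp
  then have "Determinant.det (coeff_mat P n) = prod_list (diag_mat (coeff_mat P n))"
    by (intro det_lower_triangular[of "Suc n"]) (simp_all add: coeff_mat_def)
  also have "diag_mat (coeff_mat P n) = map (\<lambda>i. 1) [0..<Suc n]"
    unfolding diag_mat_def using assms by (intro map_cong) (auto simp: coeff_mat_def)
  also have "prod_list \<dots> = 1" by (simp add: prod.distinct_set_conv_list[symmetric])
  finally show ?thesis .
qed

text \<open>Congruence by a matrix of determinant 1 preserves the determinant, and orthogonality
  makes the resulting Gram matrix diagonal.\<close>

lemma det_hankel_mat:
  assumes "\<And>k. k \<le> n \<Longrightarrow> monic_orthogonal m k (P k)"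
  shows "Determinant.det (hankel_mat m n) = (\<Prod>k\<le>n. moment_functional m (P k * P k))"
proof -
  let ?D = "Matrix.mat (Suc n) (Suc n)
    (\<lambda>(i, j). if i = j then moment_functional m (P i * P i) else 0)"
  have C: "Determinant.det (coeff_mat P n) = 1"
    using assms by (intro det_coeff_mat) (auto simp: monic_orthogonal_def)
  have "Determinant.det (hankel_mat m n) = Determinant.det
      (coeff_mat P n * hankel_mat m n * Matrix.transpose_mat (coeff_mat P n))"
    using C by (simp add: det_mult[of _ "Suc n"] det_transpose[of _ "Suc n"]
        mult_carrier_mat[of _ "Suc n" "Suc n"])
  also have "\<dots> = Determinant.det ?D"
    using assms by (simp add: coeff_mat_hankel_mat_orthogonal)
  also have "\<dots> = prod_list (diag_mat ?D)"
    by (intro det_lower_triangular[of "Suc n"]) auto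
  also have "diag_mat ?D = map (\<lambda>k. moment_functional m (P k * P k)) [0..<Suc n]"
    unfolding diag_mat_def by (intro map_cong) auto
  also have "prod_list \<dots> = (\<Prod>k\<le>n. moment_functional m (P k * P k))"
    by (simp only: prod.distinct_set_conv_list[symmetric] distinct_upt set_upt atLeast0LessThan
        Suc_eq_plus1[symmetric] lessThan_Suc_atMost)
  finally show ?thesis .
qed

lemma det_hankel_mat_pos:
  assumes "positive_moments m n"
  shows "0 < Determinant.det (hankel_mat m n)"
proof -
  obtain P where P: "\<And>k. k \<le> n \<Longrightarrow> monic_orthogonal m k (P k)"
    using monic_orthogonal_exists[OF assms] by metis
  have "0 < (\<Prod>k\<le>n. moment_functional m (P k * P k))"
    using monic_orthogonal_norm_pos[OF assms _ P] by (intro prod_pos) simp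
  then show ?thesis by (simp only: det_hankel_mat[OF P])
qed

text \<open>One and the same invertible change of basis takes both Hankel matrices to the same
  diagonal matrix, and it can be undone.\<close>

lemma hankel_mat_eqI:
  assumes "\<And>k. k \<le> n \<Longrightarrow> monic_orthogonal m k (P k)"
    and "\<And>k. k \<le> n \<Longrightarrow> monic_orthogonal m' k (P k)"
    and "\<And>k. k \<le> n \<Longrightarrow> moment_functional m (P k * P k) = moment_functional m' (P k * P k)"
  shows "hankel_mat m n = hankel_mat m' n"
proof -
  let ?C = "coeff_mat P n"
  let ?T = "Matrix.transpose_mat ?C"
  have T: "?T \<in> carrier_mat (Suc n) (Suc n)" by simp
  have C: "Determinant.det ?C = 1"
    using assms(1) by (intro det_coeff_mat) (auto simp: monic_orthogonal_def)
  have eq: "?C * hankel_mat m n * ?T = ?C * hankel_mat m' n * ?T"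
    using assms by (auto simp: coeff_mat_hankel_mat_orthogonal intro!: cong_mat)
  obtain B where B: "B \<in> carrier_mat (Suc n) (Suc n)" "B * ?C = 1\<^sub>m (Suc n)" "?C * B = 1\<^sub>m (Suc n)"
    using det_non_zero_imp_unit[of ?C "Suc n" "TYPE(real)" ] C
    by (auto simp: Units_def ring_mat_def)
  have BT: "Matrix.transpose_mat B \<in> carrier_mat (Suc n) (Suc n)" using B by simp
  have TB: "?T * Matrix.transpose_mat B = 1\<^sub>m (Suc n)"
    using B transpose_mult[of B "Suc n" "Suc n" ?C "Suc n"] by simp
  have undo: "B * (?C * hankel_mat x n * ?T) * Matrix.transpose_mat B = hankel_mat x n" for x
  proof -
    have H: "hankel_mat x n \<in> carrier_mat (Suc n) (Suc n)" by simp
    have "B * (?C * hankel_mat x n * ?T) * Matrix.transpose_mat B =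
        B * (?C * (hankel_mat x n * (?T * Matrix.transpose_mat B)))"
      using B(1) BT T H
      by (simp add: assoc_mult_mat[of _ "Suc n" "Suc n" _ "Suc n" _ "Suc n"]
          mult_carrier_mat[of _ "Suc n" "Suc n"] del: transpose_carrier_mat)
    also have "\<dots> = B * (?C * hankel_mat x n)"
      using TB right_mult_one_mat[OF H] by simp
    also have "\<dots> = B * ?C * hankel_mat x n"
      by (rule assoc_mult_mat[OF B(1) coeff_mat_carrier H, symmetric])
    finally show ?thesis using B(2) left_mult_one_mat[OF H] by simp
  qed
  show ?thesis
    by (rule trans[OF undo[of m, symmetric, unfolded eq] undo[of m']])
qed

subsection \<open>Symmetrization of moments\<close>

text \<open>The moments of the average of a measure and its mirror image: even ones are kept, odd
  ones become 0.\<close>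

definition symmetrized_moments :: "(nat \<Rightarrow> real) \<Rightarrow> nat \<Rightarrow> real" where
  "symmetrized_moments m i = (m i + (- 1) ^ i * m i) / 2"

text \<open>The polynomial \<open>p(-x)\<close>; reflecting a measure amounts to reflecting the
  argument of the integrand.\<close>

definition reflect_arg :: "real poly \<Rightarrow> real poly" where
  "reflect_arg p = pcompose p [:0, - 1:]"

lemma coeff_reflect_arg: "coeff (reflect_arg p) i = (- 1) ^ i * coeff p i"
  by (simp add: reflect_arg_def coeff_pcompose_linear)

lemma degree_reflect_arg [simp]: "degree (reflect_arg p) = degree p"
  by (simp add: reflect_arg_def degree_pcompose)

lemma reflect_arg_mult: "reflect_arg (p * q) = reflect_arg p * reflect_arg q"
  by (simp add: reflect_arg_def pcompose_mult)

lemma moment_functional_symmetrized: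
  "moment_functional (symmetrized_moments m) p =
     (moment_functional m p + moment_functional m (reflect_arg p)) / 2"
  by (simp add: moment_functional_def coeff_reflect_arg symmetrized_moments_def
      sum.distrib[symmetric] sum_divide_distrib algebra_simps)

lemma positive_symmetrized_moments:
  assumes "positive_moments m n"
  shows "positive_moments (symmetrized_moments m) n"
  unfolding positive_moments_def
proof (intro allI impI)
  fix p :: "real poly" assume p: "p \<noteq> 0" "degree p \<le> n"
  then obtain i where "coeff p i \<noteq> 0" by (auto simp: poly_eq_iff)
  then have "coeff (reflect_arg p) i \<noteq> 0" by (simp add: coeff_reflect_arg)
  then have "reflect_arg p \<noteq> 0" by auto
  then show "0 < moment_functional (symmetrized_moments m) (p * p)"
    using assms p
    by (simp add: positive_moments_def moment_functional_symmetrized reflect_arg_mult add_pos_pos)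
qed


text \<open>The symmetrized squared norm of \<open>Q k\<close> averages two values, each at least
  the minimum attained by \<open>P k\<close>. The bound \<open>le\<close> on the product of these
  norms forces equality for every \<open>k\<close>, and uniqueness of minimisers then gives
  \<open>Q k = P k\<close>.\<close>

lemma hankel_mat_symmetrized:
  assumes pos: "positive_moments m n"
    and le: "Determinant.det (hankel_mat (symmetrized_moments m) n) \<le> Determinant.det (hankel_mat m n)"
  shows "hankel_mat (symmetrized_moments m) n = hankel_mat m n"
proof -
  let ?m = "symmetrized_moments m"
  note pos' = positive_symmetrized_moments[OF pos]
  obtain P where P: "\<And>k. k \<le> n \<Longrightarrow> monic_orthogonal m k (P k)"
    using monic_orthogonal_exists[OF pos] by metis
  obtain Q where Q: "\<And>k. k \<le> n \<Longrightarrow> monic_orthogonal ?m k (Q k)"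
    using monic_orthogonal_exists[OF pos'] by metis
  have Qk: "degree (Q k) \<le> k" "coeff (Q k) k = 1" if "k \<le> n" for k
    using Q[OF that] by (auto simp: monic_orthogonal_def)
  have norm_pos: "0 < moment_functional m (P k * P k)" if "k \<le> n" for k
    by (rule monic_orthogonal_norm_pos[OF pos that P[OF that]])
  have le1: "moment_functional m (P k * P k) \<le> moment_functional m (Q k * Q k)" if "k \<le> n" for k
    by (rule monic_orthogonal_minimal(1)[OF pos that P[OF that] Qk[OF that]])
  have le2: "moment_functional m (P k * P k) \<le>
      moment_functional m (reflect_arg (Q k) * reflect_arg (Q k))" if "k \<le> n" for k
  proof -
    \<comment> \<open>Reflection multiplies the leading coefficient by \<open>(- 1) ^ k\<close>;
      this sign makes the polynomial monic again and cancels in the square.\<close>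
    define R where "R = Polynomial.smult ((- 1) ^ k) (reflect_arg (Q k))"
    have "degree R \<le> k" "coeff R k = 1"
      using Qk[OF that] by (auto simp: R_def coeff_reflect_arg power_mult_distrib[symmetric])
    then have "moment_functional m (P k * P k) \<le> moment_functional m (R * R)"
      by (rule monic_orthogonal_minimal(1)[OF pos that P[OF that]])
    also have "R * R = reflect_arg (Q k) * reflect_arg (Q k)"
      by (simp add: R_def power_mult_distrib[symmetric])
    finally show ?thesis .
  qed
  have avg: "moment_functional ?m (Q k * Q k) = (moment_functional m (Q k * Q k) +
      moment_functional m (reflect_arg (Q k) * reflect_arg (Q k))) / 2" for k
    by (simp add: moment_functional_symmetrized reflect_arg_mult)
  have grow: "moment_functional m (P k * P k) \<le> moment_functional ?m (Q k * Q k)" if "k \<le> n" for k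
    using le1[OF that] le2[OF that] avg[of k] by simp
  have norm_eq: "moment_functional ?m (Q k * Q k) = moment_functional m (P k * P k)"
    if "k \<le> n" for k
  proof (rule ccontr)
    assume "\<not> ?thesis"
    then have "moment_functional m (P k * P k) < moment_functional ?m (Q k * Q k)"
      using grow[OF that] by simp
    \<comment> \<open>All factors are positive and none decreases, so a single strict increase makes
      the whole product strictly larger.\<close>
    then have "(\<Prod>k\<le>n. moment_functional m (P k * P k)) < (\<Prod>k\<le>n. moment_functional ?m (Q k * Q k))"
      using that grow norm_pos
      by (intro prod_mono_strict[of k]) (auto intro: less_imp_le less_le_trans)
    then show False
      using le by (simp add: det_hankel_mat[OF P] det_hankel_mat[OF Q])
  qed
  \<comment> \<open>An average of two numbers that are at least the minimum equals the minimum only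
    if both do, so \<open>Q k\<close> is a minimiser for \<open>m\<close> as well.\<close>
  have "Q k = P k" if "k \<le> n" for k
    using le1[OF that] le2[OF that] avg[of k] norm_eq[OF that]
    by (intro monic_orthogonal_minimal(2)[OF pos that P[OF that] Qk[OF that]]) simp
  then show ?thesis
    using P Q norm_eq by (intro hankel_mat_eqI[where P = P]) simp_all
qed

subsection \<open>Boundary points\<close>

text \<open>A point outside all intervals lies in the gap belonging to the largest \<open>k\<close>
  with \<open>x < a (2 * k - 1)\<close>. Passing to gaps gives a finite union of open intervals,
  whose frontier is easy to compute.\<close>

lemma complement_UN_support_interval:
  assumes "1 \<le> r" and dec: "\<And>i j. 1 \<le> i \<Longrightarrow> i < j \<Longrightarrow> j \<le> 2 * r \<Longrightarrow> a i > a j"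
  shows "- (\<Union>k\<in>{0..r}. support_interval a r k) = (\<Union>k\<in>{1..r}. {a (2 * k)<..<a (2 * k - 1)})"
proof (intro equalityI subsetI)
  fix x assume x: "x \<in> - (\<Union>k\<in>{0..r}. support_interval a r k)"
  then have notin: "x \<notin> support_interval a r k" if "k \<le> r" for k
    using that by auto
  define P where "P k \<longleftrightarrow> 1 \<le> k \<and> k \<le> r \<and> x < a (2 * k - 1)" for k
  define k where "k = (GREATEST k. P k)"
  have "P 1"
    using notin[of 0] assms(1) by (auto simp: P_def support_interval_def)
  then have k: "P k"
    unfolding k_def by (rule GreatestI_nat[where b = r]) (simp add: P_def)
  have "a (2 * k) < x"
  proof (cases "k = r")
    case True
    then show ?thesis
      using notin[of r] assms(1) by (auto simp: support_interval_def)
  next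
    case False
    \<comment> \<open>Maximality puts \<open>x\<close> at or above the lower end
      \<open>a (2 * k + 1)\<close> of interval \<open>k\<close>; not being in that interval, it
      exceeds the upper end.\<close>
    have "\<not> P (Suc k)"
      using Greatest_le_nat[of P "Suc k" r] unfolding k_def[symmetric] by (auto simp: P_def)
    then have "a (2 * k + 1) \<le> x"
      using k False by (simp add: P_def)
    then show ?thesis
      using k False notin[of k] by (auto simp: P_def support_interval_def)
  qed
  then show "x \<in> (\<Union>k\<in>{1..r}. {a (2 * k)<..<a (2 * k - 1)})"
    using k by (auto simp: P_def)
next
  fix x assume "x \<in> (\<Union>k\<in>{1..r}. {a (2 * k)<..<a (2 * k - 1)})"
  then obtain k where k: "1 \<le> k" "k \<le> r" "a (2 * k) < x" "x < a (2 * k - 1)"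
    by auto
  have dec': "a j \<le> a i" if "1 \<le> i" "i \<le> j" "j \<le> 2 * r" for i j
    using dec[of i j] that by (cases "i = j") auto
  have "x \<notin> support_interval a r l" if "l \<le> r" for l
  \<comment> \<open>Intervals with \<open>l < k\<close> lie to the right of the gap, all others to
    its left.\<close>
  proof (cases "l < k")
    case True
    then have "2 * l + 1 \<le> 2 * k - 1" "2 * k - 1 \<le> 2 * r" using k by auto
    then show ?thesis
      using k True dec'[of "2 * l + 1" "2 * k - 1"] by (auto simp: support_interval_def)
  next
    case False
    then show ?thesis
      using k that dec'[of "2 * k" "2 * l"] by (auto simp: support_interval_def)
  qed
  then show "x \<in> - (\<Union>k\<in>{0..r}. support_interval a r k)"
    by auto
qed

text \<open>A set and its complement share their frontier, and for the open union of gaps it is the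
  closure minus the set. Strict monotonicity keeps every endpoint out of all open gaps.\<close>

lemma frontier_UN_support_interval:
  assumes "1 \<le> r" and dec: "\<And>i j. 1 \<le> i \<Longrightarrow> i < j \<Longrightarrow> j \<le> 2 * r \<Longrightarrow> a i > a j"
  shows "frontier (\<Union>k\<in>{0..r}. support_interval a r k) = a ` {1..2 * r}"
proof -
  let ?U = "\<Union>k\<in>{1..r}. {a (2 * k)<..<a (2 * k - 1)}"
  have dec': "a j \<le> a i" if "1 \<le> i" "i \<le> j" "j \<le> 2 * r" for i j
    using dec[of i j] that by (cases "i = j") auto
  have "frontier (\<Union>k\<in>{0..r}. support_interval a r k) =
      frontier (- (\<Union>k\<in>{0..r}. support_interval a r k))"
    by (rule frontier_complement[symmetric])
  also have "\<dots> = frontier ?U"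
    using complement_UN_support_interval[of r a, OF assms] by (rule arg_cong)
  also have "\<dots> = closure ?U - ?U"
    by (simp add: frontier_def interior_open open_UN)
  also have "closure ?U = (\<Union>k\<in>{1..r}. closure {a (2 * k)<..<a (2 * k - 1)})"
    using closure_of_Union[of "(\<lambda>k. {a (2 * k)<..<a (2 * k - 1)}) ` {1..r}" euclidean]
    by (simp add: image_image)
  also have "\<dots> = (\<Union>k\<in>{1..r}. {a (2 * k)..a (2 * k - 1)})"
    using dec by (intro SUP_cong refl closure_greaterThanLessThan) auto
  also have "\<dots> - ?U = a ` {1..2 * r}"
  proof (intro equalityI subsetI)
    fix x assume "x \<in> (\<Union>k\<in>{1..r}. {a (2 * k)..a (2 * k - 1)}) - ?U"
    then obtain k where "1 \<le> k" "k \<le> r" "x = a (2 * k) \<or> x = a (2 * k - 1)"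
      by fastforce
    then show "x \<in> a ` {1..2 * r}"
      by (auto intro!: imageI simp: le_diff_conv2)
  next
    fix x assume "x \<in> a ` {1..2 * r}"
    then obtain i where i: "1 \<le> i" "i \<le> 2 * r" "x = a i" by auto
    \<comment> \<open>The gap that has \<open>a i\<close> as an endpoint: upper for odd
      \<open>i\<close>, lower for even \<open>i\<close>.\<close>
    define k where "k = (i + 1) div 2"
    have "1 \<le> k" "k \<le> r" and ik: "i = 2 * k \<or> i = 2 * k - 1"
      using i unfolding k_def by presburger+
    moreover have "a (2 * k) \<le> x" "x \<le> a (2 * k - 1)"
      using ik i \<open>1 \<le> k\<close> \<open>k \<le> r\<close> dec'[of "2 * k - 1" "2 * k"] by auto
    moreover have "x \<notin> {a (2 * l)<..<a (2 * l - 1)}" if "1 \<le> l" "l \<le> r" for l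
    proof (cases "i \<ge> 2 * l")
      case True
      then show ?thesis using dec'[of "2 * l" i] i that by auto
    next
      case False
      then have "i \<le> 2 * l - 1" "2 * l - 1 \<le> 2 * r" using that by auto
      then show ?thesis using dec'[of i "2 * l - 1"] i by auto
    qed
    ultimately show "x \<in> (\<Union>k\<in>{1..r}. {a (2 * k)..a (2 * k - 1)}) - ?U"
      by auto
  qed
  finally show ?thesis .
qed

text \<open>Reading \<open>a\<close> backwards and negating \<open>a\<close> both list the same
  finite set in increasing order, and such a list is unique.\<close>

lemma decreasing_enumeration_symmetric:
  fixes a :: "nat \<Rightarrow> real"
  assumes dec: "\<And>i j. 1 \<le> i \<Longrightarrow> i < j \<Longrightarrow> j \<le> n \<Longrightarrow> a i > a j"
    and sym: "uminus ` a ` {1..n} = a ` {1..n}"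
    and k: "1 \<le> k" "k \<le> n"
  shows "a (n + 1 - k) = - a k"
proof -
  let ?xs = "map (\<lambda>i. a (n - i)) [0..<n]" and ?ys = "map (\<lambda>i. - a (Suc i)) [0..<n]"
  have "sorted_wrt (<) ?xs" "sorted_wrt (<) ?ys"
    using dec by (auto simp: sorted_wrt_iff_nth_less)
  moreover have "set ?xs = set ?ys"
  proof -
    have "(\<lambda>i. n - i) ` {0..<n} = {1..n}"
    proof (intro equalityI subsetI)
      fix i assume "i \<in> {1..n}"
      then show "i \<in> (\<lambda>i. n - i) ` {0..<n}"
        by (intro image_eqI[of _ _ "n - i"]) auto
    qed auto
    moreover have "set ?xs = a ` (\<lambda>i. n - i) ` {0..<n}"
      by (simp add: image_image)
    moreover have "set ?ys = uminus ` a ` Suc ` {0..<n}"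
      unfolding set_map set_upt image_image ..
    moreover have "Suc ` {0..<n} = {1..n}"
      by (simp add: atLeastLessThanSuc_atLeastAtMost)
    ultimately show ?thesis using sym by simp
  qed
  ultimately have "?xs = ?ys"
    by (intro sorted_distinct_set_unique) (simp_all add: strict_sorted_iff)
  \<comment> \<open>Lists count from 0: position \<open>k - 1\<close> holds
    \<open>a (n + 1 - k)\<close> in one list and \<open>- a k\<close> in the other.\<close>
  from arg_cong[OF this, of "\<lambda>zs. zs ! (k - 1)"] show ?thesis
    using k by (simp del: map_eq_conv)
qed

lemma support_interval_symmetric:
  assumes "1 \<le> r" "k \<le> r"
    and sym: "\<And>k. 1 \<le> k \<Longrightarrow> k \<le> 2 * r \<Longrightarrow> a (2 * r + 1 - k) = - a k"
  shows "support_interval a r (r - k) = uminus ` support_interval a r k"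
proof -
  consider "k = 0" | "k = r" | "0 < k" "k < r" using assms(2) by linarith
  then show ?thesis
  proof cases
    case 1
    then show ?thesis using assms(1) sym[of 1] by (simp add: support_interval_def)
  next
    case 2
    then show ?thesis using assms(1) sym[of "2 * r"] by (simp add: support_interval_def)
  next
    case 3
    \<comment> \<open>Negation swaps the two ends of an interval, so the upper index
      \<open>2 * k\<close> is sent to a lower one and conversely.\<close>
    then have "2 * r + 1 - (2 * k) = 2 * (r - k) + 1" "2 * r + 1 - (2 * k + 1) = 2 * (r - k)"
      by auto
    then show ?thesis
      using 3 sym[of "2 * k"] sym[of "2 * k + 1"] by (simp add: support_interval_def)
  qed
qed

subsection \<open>Designs and their sensitivity\<close>

lemma prob_density_integrable:
  assumes "is_prob_density fX"
  shows "integrable lborel fX"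
proof (rule integrableI_nonneg)
  have "(\<integral>\<^sup>+ x. ennreal (fX x) \<partial>lborel) = emeasure (density lborel fX) UNIV"
    using assms by (simp add: is_prob_density_def emeasure_density)
  also have "\<dots> = 1"
    using assms prob_space.emeasure_space_1[of "density lborel fX"]
    by (simp add: is_prob_density_def)
  finally show "(\<integral>\<^sup>+ x. ennreal (fX x) \<partial>lborel) < \<infinity>" by simp
qed (use assms in \<open>auto simp: is_prob_density_def\<close>)

lemma integrable_moment_dominated:
  fixes f g :: "real \<Rightarrow> real"
  assumes [measurable]: "f \<in> borel_measurable borel"
    and f: "\<And>x. 0 \<le> f x" "\<And>x. f x \<le> g x"
    and "integrable lborel g" "integrable lborel (\<lambda>x. \<bar>x\<bar> ^ n * g x)" "i \<le> n"
  shows "integrable lborel (\<lambda>x. x ^ i * f x)"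
proof (rule Bochner_Integration.integrable_bound)
  show "integrable lborel (\<lambda>x. g x + \<bar>x\<bar> ^ n * g x)"
    using assms by simp
  show "(\<lambda>x. x ^ i * f x) \<in> borel_measurable lborel" by measurable
  have "norm (x ^ i * f x) \<le> norm (g x + \<bar>x\<bar> ^ n * g x)" for x
  proof -
    \<comment> \<open>The constant covers \<open>\<bar>x\<bar> \<le> 1\<close> and the highest power
      covers the rest, so the integrals of \<open>g\<close> and of its top moment suffice.\<close>
    have "\<bar>x\<bar> ^ i \<le> 1 + \<bar>x\<bar> ^ n"
    proof (cases "\<bar>x\<bar> \<le> 1")
      case True
      then show ?thesis
        using power_le_one[of "\<bar>x\<bar>" i] zero_le_power[of "\<bar>x\<bar>" n] by linarith
    next
      case False
      then have "\<bar>x\<bar> ^ i \<le> \<bar>x\<bar> ^ n"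
        using \<open>i \<le> n\<close> by (intro power_increasing) simp_all
      then show ?thesis by simp
    qed
    then have "\<bar>x\<bar> ^ i * f x \<le> (1 + \<bar>x\<bar> ^ n) * g x"
      using f[of x] by (intro mult_mono) auto
    also have "\<dots> \<le> norm (g x + \<bar>x\<bar> ^ n * g x)" by (simp add: algebra_simps)
    finally show ?thesis using f(1)[of x] by (simp add: abs_mult power_abs)
  qed
  then show "AE x in lborel. norm (x ^ i * f x) \<le> norm (g x + \<bar>x\<bar> ^ n * g x)" by simp
qed

text \<open>The quadratic form is the integral of \<open>p\<close> squared times \<open>f\<close>.
  Were it 0, then \<open>f\<close> would vanish almost everywhere off the finitely many roots of
  \<open>p\<close>, contradicting positive mass.\<close>

lemma positive_moments_density:
  fixes f :: "real \<Rightarrow> real"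
  assumes nonneg: "\<And>x. 0 \<le> f x"
    and int: "\<And>i. i \<le> 2 * n \<Longrightarrow> integrable lborel (\<lambda>x. x ^ i * f x)"
    and pos: "0 < (\<integral>x. f x \<partial>lborel)"
  shows "positive_moments (\<lambda>i. \<integral>x. x ^ i * f x \<partial>lborel) n"
  unfolding positive_moments_def
proof (intro allI impI)
  fix p :: "real poly" assume p: "p \<noteq> 0" "degree p \<le> n"
  let ?g = "\<lambda>x. (poly p x)\<^sup>2 * f x"
  have deg: "degree (p * p) \<le> 2 * n"
    using p by (intro order_trans[OF degree_mult_le]) simp
  have int': "integrable lborel (\<lambda>x. coeff (p * p) i * (x ^ i * f x))" if "i \<le> degree (p * p)" for i
    using int[of i] deg that by simp
  \<comment> \<open>Expansion into monomials reduces integrability and evaluation of the integral to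
    the moments of order at most \<open>2 * n\<close>.\<close>
  have g: "?g = (\<lambda>x. \<Sum>i\<le>degree (p * p). coeff (p * p) i * (x ^ i * f x))"
    by (simp add: power2_eq_square poly_mult[symmetric] poly_altdef[of "p * p"]
        sum_distrib_right mult.assoc del: poly_mult)
  have int_g: "integrable lborel ?g"
    unfolding g using int' by (intro Bochner_Integration.integrable_sum) auto
  have eq: "moment_functional (\<lambda>i. \<integral>x. x ^ i * f x \<partial>lborel) (p * p) = (\<integral>x. ?g x \<partial>lborel)"
    unfolding g moment_functional_def
    by (subst Bochner_Integration.integral_sum) (use int' in auto)
  have "(\<integral>x. ?g x \<partial>lborel) \<noteq> 0"
  proof
    assume "(\<integral>x. ?g x \<partial>lborel) = 0"
    then have "AE x in lborel. ?g x = 0"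
      using integral_nonneg_eq_0_iff_AE[OF int_g] nonneg by simp
    moreover have "AE x in lborel. x \<notin> {x. poly p x = 0}"
      using poly_roots_finite[OF p(1)] by (intro AE_not_in finite_imp_null_set_lborel)
    ultimately have "AE x in lborel. f x = 0"
      by eventually_elim auto
    then have "(\<integral>x. f x \<partial>lborel) = 0" by (rule integral_eq_zero_AE)
    with pos show False by simp
  qed
  moreover have "0 \<le> (\<integral>x. ?g x \<partial>lborel)"
    using nonneg by (intro Bochner_Integration.integral_nonneg) simp
  ultimately show "0 < moment_functional (\<lambda>i. \<integral>x. x ^ i * f x \<partial>lborel) (p * p)"
    unfolding eq by simp
qed

lemma moment_reflected_density:
  fixes f :: "real \<Rightarrow> real"
  shows "integrable lborel (\<lambda>x. x ^ i * f x) \<Longrightarrow> integrable lborel (\<lambda>x. x ^ i * f (- x))"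
    and "(\<integral>x. x ^ i * f (- x) \<partial>lborel) = (- 1) ^ i * (\<integral>x. x ^ i * f x \<partial>lborel)"
proof -
  have eq: "x ^ i * f (- x) = (- 1) ^ i * ((- x) ^ i * f (- x))" for x
    by (cases "even i") simp_all
  show "integrable lborel (\<lambda>x. x ^ i * f (- x))" if "integrable lborel (\<lambda>x. x ^ i * f x)"
    unfolding eq using lborel_integrable_real_affine[OF that, of "- 1" 0] by simp
  show "(\<integral>x. x ^ i * f (- x) \<partial>lborel) = (- 1) ^ i * (\<integral>x. x ^ i * f x \<partial>lborel)"
    unfolding eq using lborel_integral_real_affine[of "- 1" "\<lambda>x. x ^ i * f x" 0] by simp
qed

lemma information_matrix_hankel_mat:
  assumes "f \<in> borel_measurable borel" "\<And>x. 0 \<le> f x"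
  shows "information_matrix q (density lborel (\<lambda>x. ennreal (f x))) =
    hankel_mat (\<lambda>i. \<integral>x. x ^ i * f x \<partial>lborel) q"
  by (subst information_matrix_density[OF assms]) (simp add: hankel_mat_def power_add)

text \<open>Bounds and mass survive averaging with the mirror image, the upper bound because
  \<open>fX\<close> is even.\<close>

lemma subsampling_design_symmetrized:
  fixes f fX :: "real \<Rightarrow> real"
  assumes meas: "f \<in> borel_measurable borel" and f: "\<And>x. 0 \<le> f x" "\<And>x. f x \<le> fX x"
    and int: "integrable lborel f" "(\<integral>x. f x \<partial>lborel) = \<alpha>"
    and sym: "\<And>x. fX (- x) = fX x"
  shows "subsampling_design fX \<alpha> (density lborel (\<lambda>x. ennreal ((f x + f (- x)) / 2)))"
  unfolding subsampling_design_def
proof (intro exI[of _ "\<lambda>x. (f x + f (- x)) / 2"] conjI allI)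
  have int': "integrable lborel (\<lambda>x. f (- x))" "(\<integral>x. f (- x) \<partial>lborel) = \<alpha>"
    using moment_reflected_density[of 0 f] int by simp_all
  show "(\<lambda>x. (f x + f (- x)) / 2) \<in> borel_measurable borel"
    using meas by measurable
  show "integrable lborel (\<lambda>x. (f x + f (- x)) / 2)"
    using int int' by simp
  show "(\<integral>x. (f x + f (- x)) / 2 \<partial>lborel) = \<alpha>"
    using int int' by simp
  fix x
  show "0 \<le> (f x + f (- x)) / 2" using f(1)[of x] f(1)[of "- x"] by simp
  show "(f x + f (- x)) / 2 \<le> fX x" using f(2)[of x] f(2)[of "- x"] sym[of x] by simp
qed simp

text \<open>The hypothesis \<open>sym\<close> says that \<open>A\<close> is fixed under conjugation
  by the diagonal matrix of alternating signs. Conjugating the inverse gives another inverse of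
  \<open>A\<close>, hence the same matrix.\<close>

lemma mat_inverse_checkerboard:
  fixes A :: "real Matrix.mat"
  assumes A: "A \<in> carrier_mat n n" and det: "Determinant.det A \<noteq> 0"
    and sym: "\<And>i j. i < n \<Longrightarrow> j < n \<Longrightarrow> (- 1) ^ (i + j) * A $$ (i, j) = A $$ (i, j)"
  defines "B \<equiv> the (mat_inverse A)"
  shows "B \<in> carrier_mat n n"
    and "\<And>i j. i < n \<Longrightarrow> j < n \<Longrightarrow> (- 1) ^ (i + j) * B $$ (i, j) = B $$ (i, j)"
proof -
  obtain B' where "mat_inverse A = Some B'"
    using mat_inverse(1)[OF A] det_non_zero_imp_unit[OF A det] by fastforce
  then have "mat_inverse A = Some B" by (simp add: B_def)
  from mat_inverse(2)[OF A this]
  have AB: "A * B = 1\<^sub>m n" and BA: "B * A = 1\<^sub>m n" and B: "B \<in> carrier_mat n n"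
    by auto
  show "B \<in> carrier_mat n n" by (fact B)
  define C where "C = Matrix.mat n n (\<lambda>(i, j). (- 1) ^ (i + j) * B $$ (i, j))"
  have C: "C \<in> carrier_mat n n" by (simp add: C_def)
  have "A * C = 1\<^sub>m n"
  proof (rule eq_matI)
    fix i j assume "i < dim_row (1\<^sub>m n :: real Matrix.mat)" "j < dim_col (1\<^sub>m n :: real Matrix.mat)"
    then have ij: "i < n" "j < n" by auto
    have "(A * C) $$ (i, j) = (\<Sum>k<n. A $$ (i, k) * ((- 1) ^ (k + j) * B $$ (k, j)))"
      using A ij by (simp add: C_def scalar_prod_def atLeast0LessThan)
    also have "\<dots> = (\<Sum>k<n. (- 1) ^ (i + j) * (A $$ (i, k) * B $$ (k, j)))"
    proof (rule sum.cong)
      fix k assume "k \<in> {..<n}"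
      then have "A $$ (i, k) * ((- 1) ^ (k + j) * B $$ (k, j)) =
          ((- 1) ^ (i + k) * A $$ (i, k)) * ((- 1) ^ (k + j) * B $$ (k, j))"
        using sym ij by simp
      then show "A $$ (i, k) * ((- 1) ^ (k + j) * B $$ (k, j)) =
          (- 1) ^ (i + j) * (A $$ (i, k) * B $$ (k, j))"
        by (simp add: power_add mult_ac)
    qed simp
    also have "\<dots> = (- 1) ^ (i + j) * (A * B) $$ (i, j)"
      using A B ij by (simp add: scalar_prod_def atLeast0LessThan sum_distrib_left)
    \<comment> \<open>The sign is 1 on the diagonal and meets only zeros elsewhere.\<close>
    also have "\<dots> = 1\<^sub>m n $$ (i, j)"
      using ij by (simp add: AB power_add)
    finally show "(A * C) $$ (i, j) = 1\<^sub>m n $$ (i, j)" .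
  qed (use A C in auto)
  have "C = B * A * C"
    using C BA by simp
  also have "\<dots> = B * (A * C)"
    by (rule assoc_mult_mat[OF B A C])
  also have "\<dots> = B" using \<open>A * C = 1\<^sub>m n\<close> B by simp
  finally have "C = B" .
  show "(- 1) ^ (i + j) * B $$ (i, j) = B $$ (i, j)" if "i < n" "j < n" for i j
    using arg_cong[OF \<open>C = B\<close>, of "\<lambda>M. M $$ (i, j)"] that by (simp add: C_def)
qed

text \<open>The odd moments vanish, so the information matrix and its inverse have zeros wherever
  \<open>i + j\<close> is odd; the quadratic form in \<open>x\<close> then contains even powers
  only.\<close>

lemma sensitivity_even:
  assumes M: "information_matrix q \<xi> = hankel_mat m q" and pos: "positive_moments m q"
    and eq: "hankel_mat (symmetrized_moments m) q = hankel_mat m q"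
  shows "sensitivity q \<alpha> \<xi> (- x) = sensitivity q \<alpha> \<xi> x"
proof -
  define B where "B = the (mat_inverse (hankel_mat m q))"
  \<comment> \<open>A moment equal to its symmetrization is unchanged by the sign
    \<open>(- 1) ^ (i + j)\<close>.\<close>
  have "(- 1) ^ (i + j) * hankel_mat m q $$ (i, j) = hankel_mat m q $$ (i, j)"
    if "i < Suc q" "j < Suc q" for i j
    using that arg_cong[OF eq, of "\<lambda>M. M $$ (i, j)"]
    by (simp add: hankel_mat_def symmetrized_moments_def)
  then have B: "B \<in> carrier_mat (Suc q) (Suc q)"
    "\<And>i j. i < Suc q \<Longrightarrow> j < Suc q \<Longrightarrow> (- 1) ^ (i + j) * B $$ (i, j) = B $$ (i, j)"
    unfolding B_def
    using mat_inverse_checkerboard[OF hankel_mat_carrier] det_hankel_mat_pos[OF pos] by auto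
  have sens: "sensitivity q \<alpha> \<xi> y = \<alpha> * (\<Sum>i<Suc q. \<Sum>j<Suc q. y ^ i * (B $$ (i, j) * y ^ j))" for y
    using B(1) by (simp add: sensitivity_def M B_def[symmetric] regression_vec_def scalar_prod_def
        atLeast0LessThan sum_distrib_left del: sum.lessThan_Suc)
  have "(- x) ^ i * (B $$ (i, j) * (- x) ^ j) = x ^ i * (B $$ (i, j) * x ^ j)"
    if "i < Suc q" "j < Suc q" for i j
  proof -
    have "(- x) ^ i * (B $$ (i, j) * (- x) ^ j) = x ^ i * (((- 1) ^ (i + j) * B $$ (i, j)) * x ^ j)"
      by (subst (1 2) power_minus) (simp add: power_add)
    then show ?thesis by (simp only: B(2)[OF that])
  qed
  then show ?thesis
    unfolding sens by (intro arg_cong[of _ _ "\<lambda>y. \<alpha> * y"] sum.cong) auto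
qed

text \<open>The competitor tested against optimality is the average of the design and its mirror
  image, whose moments are the symmetrized ones.\<close>

lemma D_optimal_sensitivity_even:
  assumes \<alpha>: "0 < \<alpha>" and dens: "is_prob_density fX" and sym: "\<And>x. fX (- x) = fX x"
    and mom: "integrable lborel (\<lambda>x. \<bar>x\<bar> ^ (2 * q) * fX x)" and opt: "D_optimal q fX \<alpha> \<xi>"
  shows "sensitivity q \<alpha> \<xi> (- x) = sensitivity q \<alpha> \<xi> x"
proof -
  obtain f where meas: "f \<in> borel_measurable borel" and f: "\<And>x. 0 \<le> f x" "\<And>x. f x \<le> fX x"
    and int: "integrable lborel f" "(\<integral>x. f x \<partial>lborel) = \<alpha>"
    and \<xi>: "\<xi> = density lborel (\<lambda>x. ennreal (f x))"
    using opt unfolding D_optimal_def subsampling_design_def by auto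
  define m where "m i = (\<integral>x. x ^ i * f x \<partial>lborel)" for i
  let ?g = "\<lambda>x. (f x + f (- x)) / 2"
  have int_m: "integrable lborel (\<lambda>x. x ^ i * f x)" if "i \<le> 2 * q" for i
    using that by (intro integrable_moment_dominated[OF meas f prob_density_integrable[OF dens] mom])
  have pos: "positive_moments m q"
    unfolding m_def using f(1) int_m int(2) \<alpha> by (intro positive_moments_density) auto
  have M: "information_matrix q \<xi> = hankel_mat m q"
    unfolding \<xi> m_def by (rule information_matrix_hankel_mat[OF meas f(1)])
  \<comment> \<open>The Hankel matrix involves orders up to \<open>2 * q\<close> only, for which
    \<open>mom\<close> guarantees integrability.\<close>
  have "(\<integral>x. x ^ i * ?g x \<partial>lborel) = symmetrized_moments m i" if "i \<le> 2 * q" for i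
  proof -
    have "(\<integral>x. x ^ i * ?g x \<partial>lborel) = (\<integral>x. (x ^ i * f x + x ^ i * f (- x)) / 2 \<partial>lborel)"
      by (simp add: algebra_simps)
    also have "\<dots> = symmetrized_moments m i"
      using int_m[OF that] moment_reflected_density[of i f]
      by (simp add: symmetrized_moments_def m_def)
    finally show ?thesis .
  qed
  then have "hankel_mat (\<lambda>i. \<integral>x. x ^ i * ?g x \<partial>lborel) q = hankel_mat (symmetrized_moments m) q"
    unfolding hankel_mat_def by (intro cong_mat) auto
  moreover have "?g \<in> borel_measurable borel"
    using meas by measurable
  then have "information_matrix q (density lborel (\<lambda>x. ennreal (?g x))) =
      hankel_mat (\<lambda>i. \<integral>x. x ^ i * ?g x \<partial>lborel) q"
    by (rule information_matrix_hankel_mat) (simp add: f(1))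
  ultimately have "ln (Determinant.det (hankel_mat (symmetrized_moments m) q)) \<le>
      ln (Determinant.det (hankel_mat m q))"
    using opt subsampling_design_symmetrized[OF meas f int sym]
    unfolding D_optimal_def M by metis
  \<comment> \<open>Both determinants are positive, so comparing logarithms compares the
    determinants themselves.\<close>
  then have "hankel_mat (symmetrized_moments m) q = hankel_mat m q"
    using det_hankel_mat_pos[OF pos] det_hankel_mat_pos[OF positive_symmetrized_moments[OF pos]]
    by (intro hankel_mat_symmetrized[OF pos]) simp
  then show ?thesis by (rule sensitivity_even[OF M pos])
qed

section \<open>From an even sensitivity function to symmetric boundaries\<close>

lemma frontier_uminus_invariant:
  fixes S :: "real set"
  assumes "\<And>x. - x \<in> S \<longleftrightarrow> x \<in> S"
  shows "uminus ` frontier S = frontier S"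
proof -
  have "- x \<in> frontier S" if "x \<in> frontier S" for x
    unfolding frontier_straddle
  proof (intro allI impI)
    fix e :: real assume "0 < e"
    then obtain y z where "y \<in> S" "dist x y < e" "z \<notin> S" "dist x z < e"
      using \<open>x \<in> frontier S\<close> unfolding frontier_straddle by blast
    then have "- y \<in> S" "dist (- x) (- y) < e" "- z \<notin> S" "dist (- x) (- z) < e"
      using assms by (simp_all add: dist_minus)
    then show "(\<exists>y\<in>S. dist (- x) y < e) \<and> (\<exists>y. y \<notin> S \<and> dist (- x) y < e)" by blast
  qed
  then show ?thesis
    by (auto intro!: image_eqI[where x = "- x" for x])
qed

theorem corollary3p3:
  fixes q r :: nat and \<alpha> s :: real and fX :: "real \<Rightarrow> real"
    and \<xi> :: "real measure" and a :: "nat \<Rightarrow> real"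
  assumes "q \<ge> 1" and "0 < \<alpha>" and "\<alpha> < 1"
    and "is_prob_density fX"
    and "\<And>x. fX (- x) = fX x"
    and "integrable lborel (\<lambda>x. \<bar>x\<bar> ^ (2 * q) * fX x)"
    and "D_optimal q fX \<alpha> \<xi>"
    and "1 \<le> r" and "r \<le> q"
    and "\<And>i j. 1 \<le> i \<Longrightarrow> i < j \<Longrightarrow> j \<le> 2 * r \<Longrightarrow> a i > a j"
    and "\<xi> = density lborel
           (\<lambda>x. ennreal (\<Sum>k=0..r. fX x * indicator (support_interval a r k) x))"
    and "\<And>x. x \<in> (\<Union>k\<in>{0..r}. support_interval a r k) \<Longrightarrow> sensitivity q \<alpha> \<xi> x \<ge> s"
    and "\<And>x. x \<notin> (\<Union>k\<in>{0..r}. support_interval a r k) \<Longrightarrow> sensitivity q \<alpha> \<xi> x < s"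
  shows "(\<forall>k\<in>{1..2 * r}. a (2 * r + 1 - k) = - a k) \<and>
         (\<forall>k\<in>{0..r}. support_interval a r (r - k) = uminus ` support_interval a r k)"
proof -
  let ?S = "\<Union>k\<in>{0..r}. support_interval a r k"
  \<comment> \<open>The union of the intervals is exactly a superlevel set of the sensitivity, so it
    inherits the symmetry.\<close>
  have "x \<in> ?S \<longleftrightarrow> s \<le> sensitivity q \<alpha> \<xi> x" for x
    using assms(12)[of x] assms(13)[of x] by (meson not_less)
  then have "- x \<in> ?S \<longleftrightarrow> x \<in> ?S" for x
    using D_optimal_sensitivity_even[OF assms(2,4-7)] by simp
  then have "uminus ` frontier ?S = frontier ?S"
    by (rule frontier_uminus_invariant)
  moreover have "frontier ?S = a ` {1..2 * r}"
    by (rule frontier_UN_support_interval[OF assms(8,10)])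
  ultimately have inv: "uminus ` a ` {1..2 * r} = a ` {1..2 * r}"
    by metis
  \<comment> \<open>The frontier yields symmetry of the boundary points only as a set; their strict
    order turns it into a statement about indices.\<close>
  have "a (2 * r + 1 - k) = - a k" if "1 \<le> k" "k \<le> 2 * r" for k
    by (rule decreasing_enumeration_symmetric[OF assms(10) inv that])
  then show ?thesis
    using support_interval_symmetric[of r _ a] assms(8) by auto
qed

end
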